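(* Let $T\in(0,\infty)$, $d,\delta,b\in\mathbb N$, let $D\subseteq\mathbb R^d$, let $\phi\in C(D,\mathbb R^\delta)$, let $V\subseteq C([0,T]\times D,\mathbb R^\delta)$, let $\mathscr D\colon V\to C([0,T]\times D,\mathbb R^\delta)$ and $\mathscr B\colon V\to C([0,T]\times\partial D,\mathbb R^b)$ be functions, let $u\in V$ satisfy for all $t\in[0,T]$, $x\in D$, $y\in\partial D$ that $$(\mathscr D(u))(t,x)=0,\qquad(\mathscr B(u))(t,y)=0,\qquad\text{and}\qquad u(0,x)=\phi(x),$$ let $(\Omega,\mathcal F,\mathbb P)$ be a probability space, let $\mathbb X\colon\Omega\to D$, $\mathbb Y\colon\Omega\to\partial D$, and $\mathbb T\colon\Omega\to[0,T]$ be independent random variables, assume for all $r\in(0,T)$, $s\in(r,T)$ and all open sets $\mathcal X,\mathcal Y\subseteq\mathbb R^d$ with $\mathcal X\cap D\neq\emptyset$ and $\mathcal Y\cap\partial D\neq\emptyset$ that $\mathbb P(\{\mathbb X\in\mathcal X\}\cap\{\mathbb Y\in\mathcal Y\}\cap\{r<\mathbb T<s\})>0$, and let $\ell\colon V\to[0,\infty]$ satisfy for all $v\in V$ that $$\ell(v)=\mathbb E\bigl[\|(\mathscr D(v))(\mathbb T,\mathbb X)\|^2+\|(\mathscr B(v))(\mathbb T,\mathbb Y)\|^2+\|v(0,\mathbb X)-\phi(\mathbb X)\|^2\bigr].$$ Then (i) for all $v\in V$ it holds that $\ell(v)=\inf_{w\in V}\ell(w)$ if and only if it holds for all $t\in[0,T]$,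 $x\in D$, $y\in\partial D$ that $$(\mathscr D(v))(t,x)=0,\qquad(\mathscr B(v))(t,y)=0,\qquad\text{and}\qquad v(0,x)=\phi(x),$$ and (ii) there exists $v\in V$ such that $\ell(v)=\inf_{w\in V}\ell(w)$.
   Context: $\mathbb N=\{1,2,3,\dots\}$. $\|\cdot\|$ is the Euclidean norm. $\partial D$ is the topological boundary of $D$ in $\mathbb R^d$. For a subset $A$ of a Euclidean space, $C(A,\mathbb R^k)$ is the set of continuous functions from $A$ (with the subspace topology) to $\mathbb R^k$. Random variables with values in $D$, $\partial D$, or $[0,T]$ are measurable with respect to the respective Borel sigma-algebras. The maps $\mathscr D$ and $\mathscr B$ are arbitrary (not assumed linear or continuous). *)

theory Defs
  imports "HOL-Probability.Probability"
begin

text \<open>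
  Functions with domain \<open>A\<close> are encoded as extensional functions, so that two elements of
  \<open>cont_fun A\<close> agreeing on \<open>A\<close> are equal. In particular, an operator on a subset of
  \<open>cont_fun A\<close> cannot depend on values outside of \<open>A\<close>.
\<close>

definition cont_fun :: "'a::topological_space set \<Rightarrow> ('a \<Rightarrow> 'b::topological_space) set"
  where "cont_fun A = {f \<in> extensional A. continuous_on A f}"

text \<open>
  Independence of three random variables with values in possibly different types; this is what
  the right-hand side of \<open>indep_vars_def2\<close> says, except that \<open>indep_vars\<close> forces all the
  variables to share one codomain type.
\<close>

definition indep_vars3 ::
  "'w measure \<Rightarrow> 'a measure \<Rightarrow> ('w \<Rightarrow> 'a) \<Rightarrow> 'b measure \<Rightarrow> ('w \<Rightarrow> 'b) \<Rightarrow> 'c measure \<Rightarrow> ('w \<Rightarrow> 'c) \<Rightarrow> bool"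
  where "indep_vars3 M MX X MY Y MZ Z \<longleftrightarrow>
    X \<in> measurable M MX \<and> Y \<in> measurable M MY \<and> Z \<in> measurable M MZ \<and>
    prob_space.indep_sets M
      (\<lambda>i. [{X -` A \<inter> space M | A. A \<in> sets MX},
            {Y -` A \<inter> space M | A. A \<in> sets MY},
            {Z -` A \<inter> space M | A. A \<in> sets MZ}] ! i)
      {..<3}"

end

theory Submission
  imports Defs
begin

text \<open>
  The loss of the solution \<open>u\<close> vanishes, so the minimizers are the zeros of the loss. If one of the
  three residuals of \<open>v\<close> is nonzero at some point, then by continuity its norm exceeds some
  \<open>e > 0\<close> on a relatively open box, which can be shrunk to have its time interval inside \<open>(0, T)\<close>;
  the random variables hit this box with positive probability, so the loss of \<open>v\<close> is positive.
\<close>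

text \<open>The integrand dominates \<open>e * indicator A\<close>: on \<open>A\<close> by the
  bound, off \<open>A\<close> because \<open>ennreal\<close> truncates negative values to 0. As
  \<open>nn_integral\<close> is monotone for arbitrary functions, \<open>f\<close> can be any
  function.\<close>

lemma nn_integral_pos_if_lower_bound:
  fixes f :: "'w \<Rightarrow> real"
  assumes "measure M A > 0" and "e > 0" and "\<And>\<omega>. \<omega> \<in> A \<Longrightarrow> e \<le> f \<omega>"
  shows "(\<integral>\<^sup>+\<omega>. ennreal (f \<omega>) \<partial>M) > 0"
proof -
  \<comment> \<open>A set outside the sigma-algebra has \<open>measure\<close> 0 by convention, so
    positivity already makes \<open>A\<close> measurable.\<close>
  have A: "A \<in> sets M"
    using assms(1) measure_notin_sets by fastforce
  have "0 < ennreal e * emeasure M A"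
    using assms(1,2) by (auto simp: measure_def ennreal_zero_less_mult_iff zero_less_iff_neq_zero)
  also have "\<dots> = (\<integral>\<^sup>+\<omega>. ennreal e * indicator A \<omega> \<partial>M)"
    using A by (simp add: nn_integral_cmult_indicator)
  also have "\<dots> \<le> (\<integral>\<^sup>+\<omega>. ennreal (f \<omega>) \<partial>M)"
    using assms(3) by (intro nn_integral_mono) (auto simp: indicator_def intro: ennreal_leI)
  finally show ?thesis .
qed

text \<open>By continuity the norm stays above half its value near \<open>(t, x)\<close>. The time
  \<open>t\<close> may be 0 or \<open>T\<close>, whereas the law of the random variables is
  controlled on intervals inside \<open>(0, T)\<close>; hence \<open>(r, s)\<close> is not asked to
  contain \<open>t\<close>.\<close>

lemma continuous_on_nonzero_imp_box:
  fixes g :: "real \<times> 'a::metric_space \<Rightarrow> 'b::real_normed_vector"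
  assumes "T > 0" and "continuous_on ({0..T} \<times> S) g"
    and "t \<in> {0..T}" "x \<in> S" and "g (t, x) \<noteq> 0"
  shows "\<exists>e>0. \<exists>r\<in>{0<..<T}. \<exists>s\<in>{r<..<T}. \<exists>U. open U \<and> x \<in> U \<and>
    (\<forall>t'\<in>{r<..<s}. \<forall>x'\<in>U \<inter> S. e \<le> norm (g (t', x')))"
proof -
  define e where "e = norm (g (t, x)) / 2"
  have e: "e > 0" using assms(5) by (simp add: e_def)
  have "(t, x) \<in> {0..T} \<times> S" using assms(3,4) by simp
  with assms(2) e obtain d where d: "d > 0"
    and close: "\<forall>p\<in>{0..T} \<times> S. dist p (t, x) < d \<longrightarrow> dist (g p) (g (t, x)) < e"
    unfolding continuous_on_iff by blast
  \<comment> \<open>The open intervals \<open>(0, T)\<close> and \<open>(t - d/2, t + d/2)\<close>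
    overlap even when \<open>t\<close> is an endpoint; \<open>r\<close> and \<open>s\<close> are
    then picked in the overlap.\<close>
  have "max 0 (t - d/2) < min T (t + d/2)" using assms(1,3) d by auto
  then obtain r where r: "max 0 (t - d/2) < r" "r < min T (t + d/2)" using dense by blast
  then obtain s where s: "r < s" "s < min T (t + d/2)" using dense by blast
  have "e \<le> norm (g (t', x'))"
    if t': "r < t'" "t' < s" and x': "x' \<in> ball x (d/2)" "x' \<in> S" for t' x'
  proof -
    have "\<bar>t' - t\<bar> < d/2" using t' r s by linarith
    have "dist (t', x') (t, x) \<le> dist t' t + dist x' x"
      unfolding dist_Pair_Pair by (rule sqrt_sum_squares_le_sum) auto
    also have "\<dots> < d/2 + d/2"
      using \<open>\<bar>t' - t\<bar> < d/2\<close> x' by (intro add_strict_mono) (simp_all add: dist_real_def dist_commute)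
    finally have "dist (g (t', x')) (g (t, x)) < e"
      using t' x' r s by (intro close[rule_format]) auto
    \<comment> \<open>Here \<open>norm (g (t, x))\<close> is \<open>2 * e\<close>, so a change of
      less than \<open>e\<close> leaves a norm of at least \<open>e\<close>.\<close>
    moreover have "norm (g (t, x)) \<le> norm (g (t', x')) + dist (g (t', x')) (g (t, x))"
      by (metis dist_commute dist_norm norm_triangle_sub)
    ultimately show ?thesis by (simp add: e_def)
  qed
  then have "\<forall>t'\<in>{r<..<s}. \<forall>x'\<in>ball x (d/2) \<inter> S. e \<le> norm (g (t', x'))"
    by auto
  moreover have "r \<in> {0<..<T}" "s \<in> {r<..<T}" "x \<in> ball x (d/2)"
    using r s d by auto
  ultimately show ?thesis
    using e open_ball by blast
qed

theorem corollary2p10: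
  fixes T :: real
    and D :: "(real ^ 'd) set"
    and \<phi> :: "real ^ 'd \<Rightarrow> real ^ '\<delta>"
    and V :: "(real \<times> (real ^ 'd) \<Rightarrow> real ^ '\<delta>) set"
    and \<D> :: "(real \<times> (real ^ 'd) \<Rightarrow> real ^ '\<delta>) \<Rightarrow> (real \<times> (real ^ 'd) \<Rightarrow> real ^ '\<delta>)"
    and \<B> :: "(real \<times> (real ^ 'd) \<Rightarrow> real ^ '\<delta>) \<Rightarrow> (real \<times> (real ^ 'd) \<Rightarrow> real ^ 'b)"
    and u :: "real \<times> (real ^ 'd) \<Rightarrow> real ^ '\<delta>"
    and M :: "'w measure"
    and X Y :: "'w \<Rightarrow> real ^ 'd"
    and \<tau> :: "'w \<Rightarrow> real"
    and \<L> :: "(real \<times> (real ^ 'd) \<Rightarrow> real ^ '\<delta>) \<Rightarrow> ennreal"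
  assumes "T > 0"
    and "\<phi> \<in> cont_fun D"
    and "V \<subseteq> cont_fun ({0..T} \<times> D)"
    and "\<D> \<in> V \<rightarrow> cont_fun ({0..T} \<times> D)"
    and "\<B> \<in> V \<rightarrow> cont_fun ({0..T} \<times> frontier D)"
    and "u \<in> V"
    and "\<forall>t\<in>{0..T}. \<forall>x\<in>D. \<forall>y\<in>frontier D. \<D> u (t, x) = 0 \<and> \<B> u (t, y) = 0 \<and> u (0, x) = \<phi> x"
    and "prob_space M"
    and "indep_vars3 M (restrict_space borel D) X (restrict_space borel (frontier D)) Y
           (restrict_space borel {0..T}) \<tau>"
    and "\<forall>r\<in>{0<..<T}. \<forall>s\<in>{r<..<T}. \<forall>\<X> \<Y>. open \<X> \<longrightarrow> open \<Y> \<longrightarrow>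
           \<X> \<inter> D \<noteq> {} \<longrightarrow> \<Y> \<inter> frontier D \<noteq> {} \<longrightarrow>
           measure M {\<omega> \<in> space M. X \<omega> \<in> \<X> \<and> Y \<omega> \<in> \<Y> \<and> r < \<tau> \<omega> \<and> \<tau> \<omega> < s} > 0"
    and "\<forall>v\<in>V. \<L> v = (\<integral>\<^sup>+\<omega>. ennreal ((norm (\<D> v (\<tau> \<omega>, X \<omega>)))\<^sup>2
           + (norm (\<B> v (\<tau> \<omega>, Y \<omega>)))\<^sup>2 + (norm (v (0, X \<omega>) - \<phi> (X \<omega>)))\<^sup>2) \<partial>M)"
  shows "(\<forall>v\<in>V. \<L> v = (INF w\<in>V. \<L> w) \<longleftrightarrow>
            (\<forall>t\<in>{0..T}. \<forall>x\<in>D. \<forall>y\<in>frontier D.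
               \<D> v (t, x) = 0 \<and> \<B> v (t, y) = 0 \<and> v (0, x) = \<phi> x))
       \<and> (\<exists>v\<in>V. \<L> v = (INF w\<in>V. \<L> w))"
proof -
  interpret prob_space M by fact
  let ?S = "{0..T}" and ?F = "frontier D"
  let ?res = "\<lambda>v \<omega>. (norm (\<D> v (\<tau> \<omega>, X \<omega>)))\<^sup>2
           + (norm (\<B> v (\<tau> \<omega>, Y \<omega>)))\<^sup>2 + (norm (v (0, X \<omega>) - \<phi> (X \<omega>)))\<^sup>2"
  let ?sol = "\<lambda>v. \<forall>t\<in>?S. \<forall>x\<in>D. \<forall>y\<in>?F. \<D> v (t, x) = 0 \<and> \<B> v (t, y) = 0 \<and> v (0, x) = \<phi> x"
  have X: "X \<omega> \<in> D" and Y: "Y \<omega> \<in> ?F" and \<tau>: "\<tau> \<omega> \<in> ?S" if "\<omega> \<in> space M" for \<omega>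
    using assms(9) that
    by (auto simp: indep_vars3_def space_restrict_space dest!: measurable_space)
  \<comment> \<open>A sample point shows that \<open>D\<close> and its frontier are nonempty, so
    \<open>UNIV\<close> is an admissible open set whenever \<open>X\<close> or \<open>Y\<close> is
    to be left unconstrained.\<close>
  obtain \<omega>\<^sub>0 where "\<omega>\<^sub>0 \<in> space M" using not_empty by blast
  then have DF: "X \<omega>\<^sub>0 \<in> D" "Y \<omega>\<^sub>0 \<in> ?F" using X Y by auto
  have zero: "\<L> v = 0" if "v \<in> V" and sol: "?sol v" for v
  proof -
    have "ennreal (?res v \<omega>) = 0" if "\<omega> \<in> space M" for \<omega>
    proof -
      have "\<D> v (\<tau> \<omega>, X \<omega>) = 0 \<and> \<B> v (\<tau> \<omega>, Y \<omega>) = 0 \<and> v (0, X \<omega>) = \<phi> (X \<omega>)"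
        using sol X[OF that] Y[OF that] \<tau>[OF that] by blast
      then show ?thesis by simp
    qed
    then have "(\<integral>\<^sup>+\<omega>. ennreal (?res v \<omega>) \<partial>M) = (\<integral>\<^sup>+\<omega>. 0 \<partial>M)"
      by (rule nn_integral_cong)
    with assms(11) that(1) show ?thesis by simp
  qed
  \<comment> \<open>The least value 0 of \<open>ennreal\<close> is attained at
    \<open>u\<close>.\<close>
  have Inf: "(INF w\<in>V. \<L> w) = 0"
    using zero[OF assms(6,7)] assms(6) by (metis INF_lower le_zero_eq)
  \<comment> \<open>Common end of the three cases below: a lower bound for the summed squared
    residuals on an event of positive probability. The bound is \<open>e\<^sup>2\<close> because the
    box lemma bounds a norm by \<open>e\<close>.\<close>
  have pos: "\<L> v \<noteq> 0"
    if v: "v \<in> V" and e: "e > 0" and r: "r \<in> {0<..<T}" and s: "s \<in> {r<..<T}"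
      and U: "open U" "U \<inter> D \<noteq> {}" and W: "open W" "W \<inter> ?F \<noteq> {}"
      and bound: "\<And>\<omega>. \<lbrakk>\<omega> \<in> space M; X \<omega> \<in> U; Y \<omega> \<in> W; r < \<tau> \<omega>; \<tau> \<omega> < s\<rbrakk> \<Longrightarrow> e\<^sup>2 \<le> ?res v \<omega>"
    for v e r s U W
  proof -
    have "measure M {\<omega> \<in> space M. X \<omega> \<in> U \<and> Y \<omega> \<in> W \<and> r < \<tau> \<omega> \<and> \<tau> \<omega> < s} > 0"
      using assms(10) r s U W by blast
    then have "(\<integral>\<^sup>+\<omega>. ennreal (?res v \<omega>) \<partial>M) > 0"
      by (rule nn_integral_pos_if_lower_bound[where e = "e\<^sup>2"]) (use e bound in auto)
    with assms(11) v show ?thesis by simp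
  qed
  have sol: "?sol v" if v: "v \<in> V" and L: "\<L> v = 0" for v
  proof (intro ballI conjI; rule ccontr)
    fix t x assume t: "t \<in> ?S" and x: "x \<in> D"
    show False if nz: "\<D> v (t, x) \<noteq> 0"
    proof -
      have cont: "continuous_on (?S \<times> D) (\<D> v)" using assms(4) v by (auto simp: cont_fun_def)
      obtain e r s U where box: "e > 0" "r \<in> {0<..<T}" "s \<in> {r<..<T}" "open U" "x \<in> U"
        "\<forall>t'\<in>{r<..<s}. \<forall>x'\<in>U \<inter> D. e \<le> norm (\<D> v (t', x'))"
        using continuous_on_nonzero_imp_box[OF assms(1) cont t x nz] by blast
      \<comment> \<open>The first square alone reaches \<open>e\<^sup>2\<close>; the other two are
        nonnegative. \<open>Y\<close> is unconstrained, so \<open>W\<close> becomes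
        \<open>UNIV\<close>.\<close>
      have "e\<^sup>2 \<le> ?res v \<omega>" if "\<omega> \<in> space M" "X \<omega> \<in> U" "r < \<tau> \<omega>" "\<tau> \<omega> < s" for \<omega>
        using power_mono[OF box(6)[rule_format, of "\<tau> \<omega>" "X \<omega>"], of 2] that X box(1)
        by (simp add: add_increasing2)
      then have "\<L> v \<noteq> 0"
        using x box(5) DF by (intro pos[OF v box(1-4) _ open_UNIV]) blast+
      with L show False by simp
    qed
    show False if nz: "v (0, x) \<noteq> \<phi> x"
    proof -
      \<comment> \<open>The initial residual is made a function of time and space, constant in time,
        so that the box lemma also yields the time interval that the positivity hypothesis asks
        for.\<close>
      let ?g = "\<lambda>p. v (0, snd p) - \<phi> (snd p)"
      have "continuous_on (?S \<times> D) v" "continuous_on D \<phi>"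
        using assms(2,3) v by (auto simp: cont_fun_def)
      then have "continuous_on (?S \<times> D) (\<lambda>p. v (0, snd p))"
        "continuous_on (?S \<times> D) (\<lambda>p. \<phi> (snd p))"
        using assms(1)
        by (auto intro!: continuous_on_compose2[of "?S \<times> D" v] continuous_on_compose2[of D \<phi>]
            continuous_on_Pair continuous_on_snd)
      then have cont: "continuous_on (?S \<times> D) ?g"
        by (rule continuous_on_diff)
      have nz': "?g (t, x) \<noteq> 0"
        using nz by simp
      obtain e r s U where box: "e > 0" "r \<in> {0<..<T}" "s \<in> {r<..<T}" "open U" "x \<in> U"
        "\<forall>t'\<in>{r<..<s}. \<forall>x'\<in>U \<inter> D. e \<le> norm (?g (t', x'))"
        using continuous_on_nonzero_imp_box[OF assms(1) cont t x nz'] by blast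
      have "e\<^sup>2 \<le> ?res v \<omega>" if "\<omega> \<in> space M" "X \<omega> \<in> U" "r < \<tau> \<omega>" "\<tau> \<omega> < s" for \<omega>
        using power_mono[OF box(6)[rule_format, of "\<tau> \<omega>" "X \<omega>"], of 2] that X box(1)
        by (simp add: add_increasing)
      then have "\<L> v \<noteq> 0"
        using x box(5) DF by (intro pos[OF v box(1-4) _ open_UNIV]) blast+
      with L show False by simp
    qed
  next
    fix t y assume t: "t \<in> ?S" and y: "y \<in> ?F" and nz: "\<B> v (t, y) \<noteq> 0"
    have cont: "continuous_on (?S \<times> ?F) (\<B> v)" using assms(5) v by (auto simp: cont_fun_def)
    obtain e r s W where box: "e > 0" "r \<in> {0<..<T}" "s \<in> {r<..<T}" "open W" "y \<in> W"
      "\<forall>t'\<in>{r<..<s}. \<forall>y'\<in>W \<inter> ?F. e \<le> norm (\<B> v (t', y'))"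
      using continuous_on_nonzero_imp_box[OF assms(1) cont t y nz] by blast
    \<comment> \<open>The roles of \<open>X\<close> and \<open>Y\<close> are exchanged: the box
      constrains \<open>Y\<close>, and \<open>U\<close> becomes \<open>UNIV\<close>.\<close>
    have "e\<^sup>2 \<le> ?res v \<omega>" if "\<omega> \<in> space M" "Y \<omega> \<in> W" "r < \<tau> \<omega>" "\<tau> \<omega> < s" for \<omega>
      using power_mono[OF box(6)[rule_format, of "\<tau> \<omega>" "Y \<omega>"], of 2] that Y box(1)
      by (simp add: add_increasing add_increasing2)
    then have "\<L> v \<noteq> 0"
      using y box(5) DF by (intro pos[OF v box(1-3) open_UNIV _ box(4)]) blast+
    with L show False by simp
  qed
  have "\<L> v = (INF w\<in>V. \<L> w) \<longleftrightarrow> ?sol v" if "v \<in> V" for v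
    unfolding Inf using sol zero that by blast
  then show ?thesis using assms(6,7) by blast
qed

end
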